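(* Let $\mathcal G=(G_n,\|\cdot\|_n)_{n\in\mathbb N}$ be a family of metric groups with $\sup\{\|g\|_n : n\in\mathbb N,\ g\in G_n\}<\infty$ and let $\mathcal U$ be a non-principal ultrafilter on $\mathbb N$. Then $\mathcal G^*_{\mathrm{met}}$ is simple if and only if $\mathcal G^*_{\mathrm{met}}$ is boundedly simple.
   Context: A metric group $(G,\|\cdot\|)$ is a group with a bi-invariant norm $\|\cdot\|\colon G\to[0,\infty]$: $\|e\|=0$, $\|gh\|\le\|g\|+\|h\|$, $\|g^{-1}\|=\|g\|=\|hgh^{-1}\|$, and $\|g\|=0$ iff $g=e$. The metric ultraproduct is $\mathcal G^*_{\mathrm{met}}=\prod_{n}G_n/\mathcal E$, where $\mathcal E=\{(g_n)\in\prod_n G_n : \lim_{n\to\mathcal U}\|g_n\|_n=0\}$. For a group $G$, $g\in G$ and $N\in\mathbb N$, $C_N(g,G)$ is the set of all products of at most $N$ conjugates (in $G$) of $g$ and $g^{-1}$. $G$ is boundedly simple if for every $g\in G\setminus\{e\}$ there is $N\in\mathbb N$ with $C_N(g,G)=G$. Simple means having no normal subgroups other than $\{e\}$ and the whole group (the trivial group is allowed). *)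

theory Defs
  imports "HOL-Algebra.Product_Groups" "HOL-Analysis.Analysis"
begin

locale metric_group = group G for G :: "('a, 'b) monoid_scheme" (structure) +
  fixes nrm :: "'a \<Rightarrow> ennreal"
  assumes nrm_one: "nrm \<one> = 0"
    and nrm_mult_le: "\<lbrakk>g \<in> carrier G; h \<in> carrier G\<rbrakk> \<Longrightarrow> nrm (g \<otimes> h) \<le> nrm g + nrm h"
    and nrm_inv: "g \<in> carrier G \<Longrightarrow> nrm (inv g) = nrm g"
    and nrm_conj: "\<lbrakk>g \<in> carrier G; h \<in> carrier G\<rbrakk> \<Longrightarrow> nrm (h \<otimes> g \<otimes> inv h) = nrm g"
    and nrm_eq_0_iff: "g \<in> carrier G \<Longrightarrow> nrm g = 0 \<longleftrightarrow> g = \<one>"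

text \<open>
  Isabelle's type of filters contains the improper filter \<open>bot\<close>, which has to be excluded.
\<close>

definition ultrafilter :: "'i filter \<Rightarrow> bool" where
  "ultrafilter U \<longleftrightarrow> U \<noteq> bot \<and> (\<forall>P. eventually P U \<or> eventually (\<lambda>i. \<not> P i) U)"

definition nonprincipal_ultrafilter :: "'i filter \<Rightarrow> bool" where
  "nonprincipal_ultrafilter U \<longleftrightarrow> ultrafilter U \<and> (\<forall>i. U \<noteq> principal {i})"

definition ultra_null ::
  "(nat \<Rightarrow> ('a, 'b) monoid_scheme) \<Rightarrow> (nat \<Rightarrow> 'a \<Rightarrow> ennreal) \<Rightarrow> nat filter \<Rightarrow> (nat \<Rightarrow> 'a) set" where
  "ultra_null G nrm U =
     {g \<in> carrier (product_group UNIV G). ((\<lambda>n. nrm n (g n)) \<longlongrightarrow> 0) U}"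

definition metric_ultraproduct ::
  "(nat \<Rightarrow> ('a, 'b) monoid_scheme) \<Rightarrow> (nat \<Rightarrow> 'a \<Rightarrow> ennreal) \<Rightarrow> nat filter
     \<Rightarrow> (nat \<Rightarrow> 'a) set monoid" where
  "metric_ultraproduct G nrm U = product_group UNIV G Mod ultra_null G nrm U"

definition conjugates :: "('a, 'b) monoid_scheme \<Rightarrow> 'a \<Rightarrow> 'a set" where
  "conjugates G g = {h \<otimes>\<^bsub>G\<^esub> g \<otimes>\<^bsub>G\<^esub> inv\<^bsub>G\<^esub> h | h. h \<in> carrier G}"

text \<open>
  The list of factors may be empty, so the neutral element always belongs to the set below.
\<close>

definition conj_products :: "nat \<Rightarrow> 'a \<Rightarrow> ('a, 'b) monoid_scheme \<Rightarrow> 'a set" where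
  "conj_products N g G =
     {foldr (\<otimes>\<^bsub>G\<^esub>) xs \<one>\<^bsub>G\<^esub> | xs.
        length xs \<le> N \<and> set xs \<subseteq> conjugates G g \<union> conjugates G (inv\<^bsub>G\<^esub> g)}"

definition boundedly_simple :: "('a, 'b) monoid_scheme \<Rightarrow> bool" where
  "boundedly_simple G \<longleftrightarrow>
     (\<forall>g \<in> carrier G - {\<one>\<^bsub>G\<^esub>}. \<exists>N. conj_products N g G = carrier G)"

text \<open>
  Unlike the locale \<open>simple_group\<close> of \<open>HOL-Algebra\<close>, which requires \<open>order G > 1\<close> (false for
  infinite groups, whose \<open>order\<close> is \<open>0\<close>), this covers infinite groups and the trivial group.
\<close>

definition is_simple :: "('a, 'b) monoid_scheme \<Rightarrow> bool" where
  "is_simple G \<longleftrightarrow> (\<forall>H. H \<lhd> G \<longrightarrow> H = {\<one>\<^bsub>G\<^esub>} \<or> H = carrier G)"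

end

theory Submission
  imports Defs
begin

text \<open>
  Let \<open>g\<close> be a non-trivial element of a simple ultraproduct and let \<open>D\<^sub>N\<close> be the set of products of at
  most \<open>N\<close> conjugates of \<open>g\<close> and its inverse. By countable saturation, \<open>D\<^sub>N\<close> is the set of classes of all
  sequences \<open>x\<close> whose distance to the corresponding sets in the factors tends to \<open>0\<close>; simplicity
  says that the sets \<open>D\<^sub>N\<close> cover the group. A Baire category argument then gives a ball of radius \<open>r\<close>
  around the identity inside some \<open>D\<^sub>M\<close>. Hence an element outside \<open>D\<^bsub>N+M\<^esub>\<close> has distance at least \<open>r\<close> from \<open>D\<^sub>N\<close>,
  with \<open>r\<close> independent of \<open>N\<close>. If no \<open>D\<^sub>N\<close> were the whole group, saturation would produce
  an element at distance at least \<open>r\<close> from every \<open>D\<^sub>N\<close>, a contradiction.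
\<close>

section \<open>Products of conjugates\<close>

lemma (in group) conjugates_subset: "g \<in> carrier G \<Longrightarrow> conjugates G g \<subseteq> carrier G"
  by (auto simp: conjugates_def)

lemma (in group) conjugates_conj:
  assumes "g \<in> carrier G" "a \<in> conjugates G g" "p \<in> carrier G"
  shows "p \<otimes> a \<otimes> inv p \<in> conjugates G g"
proof -
  obtain h where h: "h \<in> carrier G" "a = h \<otimes> g \<otimes> inv h"
    using assms by (auto simp: conjugates_def)
  then have "p \<otimes> a \<otimes> inv p = (p \<otimes> h) \<otimes> g \<otimes> inv (p \<otimes> h)"
    using assms by (simp add: m_assoc inv_mult_group)
  then show ?thesis
    using assms h by (auto simp: conjugates_def)
qed

lemma (in group) conjugates_inv:
  assumes "g \<in> carrier G" "a \<in> conjugates G g"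
  shows "inv a \<in> conjugates G (inv g)"
proof -
  obtain h where h: "h \<in> carrier G" "a = h \<otimes> g \<otimes> inv h"
    using assms by (auto simp: conjugates_def)
  then have "inv a = h \<otimes> inv g \<otimes> inv h"
    using assms by (simp add: m_assoc inv_mult_group)
  then show ?thesis
    using assms h by (auto simp: conjugates_def)
qed

lemma conj_products_mono: "M \<le> N \<Longrightarrow> conj_products M g G \<subseteq> conj_products N g G"
  by (force simp: conj_products_def)

lemma conj_products_0: "conj_products 0 g G = {\<one>\<^bsub>G\<^esub>}"
  by (auto simp: conj_products_def)

lemma one_in_conj_products: "\<one>\<^bsub>G\<^esub> \<in> conj_products N g G"
  by (force simp: conj_products_def intro: exI[of _ "[]"])

text \<open>This recursion replaces lists in the later inductions. The inserted identity accounts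
  for the empty list.\<close>

lemma conj_products_Suc:
  "conj_products (Suc N) g G =
     insert \<one>\<^bsub>G\<^esub> {a \<otimes>\<^bsub>G\<^esub> c | a c. a \<in> conjugates G g \<union> conjugates G (inv\<^bsub>G\<^esub> g) \<and> c \<in> conj_products N g G}"
  (is "?L = ?R")
proof
  show "?L \<subseteq> ?R"
  proof
    fix x assume "x \<in> ?L"
    then obtain xs where xs: "x = foldr (\<otimes>\<^bsub>G\<^esub>) xs \<one>\<^bsub>G\<^esub>" "length xs \<le> Suc N"
        "set xs \<subseteq> conjugates G g \<union> conjugates G (inv\<^bsub>G\<^esub> g)"
      unfolding conj_products_def by blast
    show "x \<in> ?R"
    proof (cases xs)
      case Nil
      then show ?thesis using xs by simp
    next
      case (Cons a ys)
      then have "foldr (\<otimes>\<^bsub>G\<^esub>) ys \<one>\<^bsub>G\<^esub> \<in> conj_products N g G"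
        using xs unfolding conj_products_def by auto
      then show ?thesis using xs Cons by auto
    qed
  qed
next
  have "a \<otimes>\<^bsub>G\<^esub> c \<in> ?L" if a: "a \<in> conjugates G g \<union> conjugates G (inv\<^bsub>G\<^esub> g)"
    and c: "c \<in> conj_products N g G" for a c
  proof -
    obtain ys where ys: "c = foldr (\<otimes>\<^bsub>G\<^esub>) ys \<one>\<^bsub>G\<^esub>" "length ys \<le> N"
        "set ys \<subseteq> conjugates G g \<union> conjugates G (inv\<^bsub>G\<^esub> g)"
      using c unfolding conj_products_def by blast
    then show ?thesis
      unfolding conj_products_def using a by (intro CollectI exI[of _ "a # ys"]) auto
  qed
  then show "?R \<subseteq> ?L"
    using one_in_conj_products[of G "Suc N" g] by blast
qed

lemma (in group) conj_products_subset:
  assumes "g \<in> carrier G" shows "conj_products N g G \<subseteq> carrier G"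
proof (induction N)
  case (Suc N)
  then show ?case
    using conjugates_subset[OF assms] conjugates_subset[OF inv_closed[OF assms]]
    unfolding conj_products_Suc by blast
qed (simp add: conj_products_0)

lemma (in group) conj_products_mult:
  assumes g: "g \<in> carrier G" and x: "x \<in> conj_products M g G" and y: "y \<in> conj_products N g G"
  shows "x \<otimes> y \<in> conj_products (M + N) g G"
  using x
proof (induction M arbitrary: x)
  case 0
  then show ?case
    using y subsetD[OF conj_products_subset[OF g] y] by (simp add: conj_products_0)
next
  case (Suc M)
  have yc: "y \<in> carrier G"
    using y conj_products_subset[OF g] by blast
  consider "x = \<one>" | a c where "a \<in> conjugates G g \<union> conjugates G (inv g)"
      "c \<in> conj_products M g G" "x = a \<otimes> c"
    using Suc.prems unfolding conj_products_Suc by blast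
  then show ?case
  proof cases
    case 1
    then show ?thesis
      using y yc conj_products_mono[of N "Suc M + N" g G] by auto
  next
    case 2
    have "a \<in> carrier G" "c \<in> carrier G"
      using 2 conjugates_subset g conj_products_subset[OF g] by blast+
    then have "x \<otimes> y = a \<otimes> (c \<otimes> y)"
      using 2 yc by (simp add: m_assoc)
    then show ?thesis
      using 2 Suc.IH[OF 2(2)] unfolding add_Suc conj_products_Suc by blast
  qed
qed

lemma (in group) conj_products_inv:
  assumes g: "g \<in> carrier G" and x: "x \<in> conj_products N g G"
  shows "inv x \<in> conj_products N g G"
  using x
proof (induction N arbitrary: x)
  case 0
  then show ?case by (simp add: conj_products_0)
next
  case (Suc N)
  consider "x = \<one>" | a c where "a \<in> conjugates G g \<union> conjugates G (inv g)"
      "c \<in> conj_products N g G" "x = a \<otimes> c"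
    using Suc.prems unfolding conj_products_Suc by blast
  then show ?case
  proof cases
    case 1
    then show ?thesis by (simp add: one_in_conj_products)
  next
    case 2
    have c: "a \<in> carrier G" "c \<in> carrier G"
      using 2 conjugates_subset g conj_products_subset[OF g] by blast+
    have "inv a \<in> conjugates G g \<union> conjugates G (inv g)"
      using 2(1) conjugates_inv[OF g, of a] conjugates_inv[OF inv_closed[OF g], of a] g by auto
    \<comment> \<open>Inversion reverses the factors, so \<open>inv a\<close> has to stand to the
      right of \<open>inv c\<close>; as a product with one factor it can be appended by
      \<open>conj_products_mult\<close>.\<close>
    then have "inv a \<otimes> \<one> \<in> conj_products (Suc 0) g G"
      using one_in_conj_products[of G 0 g] unfolding conj_products_Suc[of 0] by fast
    then have "inv c \<otimes> inv a \<in> conj_products (N + Suc 0) g G"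
      using conj_products_mult[OF g Suc.IH[OF 2(2)], of "inv a" "Suc 0"] c by simp
    then show ?thesis
      using 2 c by (simp add: inv_mult_group)
  qed
qed

lemma (in group) conj_products_conj:
  assumes g: "g \<in> carrier G" and p: "p \<in> carrier G" and x: "x \<in> conj_products N g G"
  shows "p \<otimes> x \<otimes> inv p \<in> conj_products N g G"
  using x
proof (induction N arbitrary: x)
  case 0
  then show ?case using p by (simp add: conj_products_0)
next
  case (Suc N)
  consider "x = \<one>" | a c where "a \<in> conjugates G g \<union> conjugates G (inv g)"
      "c \<in> conj_products N g G" "x = a \<otimes> c"
    using Suc.prems unfolding conj_products_Suc by blast
  then show ?case
  proof cases
    case 1
    then show ?thesis using p by (simp add: one_in_conj_products)
  next
    case 2
    have c: "a \<in> carrier G" "c \<in> carrier G"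
      using 2 conjugates_subset g conj_products_subset[OF g] by blast+
    have "p \<otimes> a \<otimes> inv p \<in> conjugates G g \<union> conjugates G (inv g)"
      using 2(1) conjugates_conj[OF g _ p, of a] conjugates_conj[OF inv_closed[OF g] _ p, of a] by auto
    moreover have "p \<otimes> x \<otimes> inv p = (p \<otimes> a \<otimes> inv p) \<otimes> (p \<otimes> c \<otimes> inv p)"
    proof -
      have "inv p \<otimes> (p \<otimes> (c \<otimes> inv p)) = c \<otimes> inv p"
        using p c by (simp add: m_assoc[symmetric])
      then show ?thesis using 2 p c by (simp add: m_assoc)
    qed
    ultimately show ?thesis
      using Suc.IH[OF 2(2)] unfolding conj_products_Suc by blast
  qed
qed

lemma (in group) conj_products_subset_normal:
  assumes H: "H \<lhd> G" and g: "g \<in> H"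
  shows "conj_products N g G \<subseteq> H"
proof -
  interpret H: normal H G by (rule H)
  have *: "conjugates G h \<subseteq> H" if "h \<in> H" for h
    using that H.inv_op_closed2 by (auto simp: conjugates_def)
  show ?thesis
  proof (induction N)
    case 0
    then show ?case by (simp add: conj_products_0)
  next
    case (Suc N)
    then show ?case
      using *[OF g] *[OF H.m_inv_closed[OF g]] unfolding conj_products_Suc by auto
  qed
qed

text \<open>The conjugate products of a non-trivial element of \<open>H\<close> stay in
  \<open>H\<close>, yet for some length they exhaust the group.\<close>

lemma (in group) boundedly_simple_imp_is_simple:
  assumes "boundedly_simple G" shows "is_simple G"
  unfolding is_simple_def
proof (intro allI impI disjCI)
  fix H assume H: "H \<lhd> G" and ne: "H \<noteq> carrier G"
  interpret H: normal H G by (rule H)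
  have "g = \<one>" if g: "g \<in> H" for g
  proof (rule ccontr)
    assume "g \<noteq> \<one>"
    then obtain N where "conj_products N g G = carrier G"
      using assms g H.subset unfolding boundedly_simple_def by blast
    then show False
      using conj_products_subset_normal[OF H g, of N] H.subset ne by blast
  qed
  then show "H = {\<one>}" using H.one_closed by blast
qed

section \<open>Metric groups and saturation\<close>

context metric_group
begin

text \<open>The left-invariant distance of the norm. Conjugation invariance makes it right-invariant
  too, which underlies \<open>dst_mult\<close>, \<open>dst_inv\<close> and
  \<open>dst_conj\<close>.\<close>

definition dst :: "'a \<Rightarrow> 'a \<Rightarrow> ennreal" where
  "dst x y = nrm (inv x \<otimes> y)"

lemma dst_self: "x \<in> carrier G \<Longrightarrow> dst x x = 0"
  by (simp add: dst_def nrm_one)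

lemma dst_triangle:
  assumes "x \<in> carrier G" "y \<in> carrier G" "z \<in> carrier G"
  shows "dst x z \<le> dst x y + dst y z"
proof -
  have "y \<otimes> (inv y \<otimes> z) = z"
    using assms by (simp add: m_assoc[symmetric])
  then have "inv x \<otimes> z = (inv x \<otimes> y) \<otimes> (inv y \<otimes> z)"
    using assms by (simp add: m_assoc)
  then show ?thesis
    unfolding dst_def using nrm_mult_le assms by simp
qed

lemma dst_commute:
  assumes "x \<in> carrier G" "y \<in> carrier G"
  shows "dst x y = dst y x"
  using nrm_inv[of "inv x \<otimes> y"] assms by (simp add: dst_def inv_mult_group)

text \<open>The quotient of the two products splits into the conjugate of
  \<open>inv x \<otimes> c\<close> by \<open>inv y\<close>, whose norm is unchanged, and the factor
  \<open>inv y \<otimes> d\<close>.\<close>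

lemma dst_mult:
  assumes "x \<in> carrier G" "y \<in> carrier G" "c \<in> carrier G" "d \<in> carrier G"
  shows "dst (x \<otimes> y) (c \<otimes> d) \<le> dst x c + dst y d"
proof -
  have "y \<otimes> (inv y \<otimes> d) = d"
    using assms by (simp add: m_assoc[symmetric])
  then have "inv (x \<otimes> y) \<otimes> (c \<otimes> d) = (inv y \<otimes> (inv x \<otimes> c) \<otimes> inv (inv y)) \<otimes> (inv y \<otimes> d)"
    using assms by (simp add: inv_mult_group m_assoc)
  then show ?thesis
    unfolding dst_def
    using nrm_mult_le[of "inv y \<otimes> (inv x \<otimes> c) \<otimes> inv (inv y)" "inv y \<otimes> d"]
      nrm_conj[of "inv x \<otimes> c" "inv y"] assms by simp
qed

lemma dst_inv:
  assumes "x \<in> carrier G" "c \<in> carrier G"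
  shows "dst (inv x) (inv c) = dst x c"
proof -
  \<comment> \<open>\<open>inv x \<otimes> c\<close> is conjugate to
    \<open>c \<otimes> inv x\<close>, whose inverse is the quotient of the inverted pair.\<close>
  have "inv x \<otimes> (c \<otimes> inv x) \<otimes> inv (inv x) = inv x \<otimes> c"
    using assms by (simp add: m_assoc)
  then have "dst x c = nrm (c \<otimes> inv x)"
    using nrm_conj[of "c \<otimes> inv x" "inv x"] assms by (simp add: dst_def)
  also have "\<dots> = nrm (x \<otimes> inv c)"
    using nrm_inv[of "c \<otimes> inv x"] assms by (simp add: inv_mult_group)
  finally show ?thesis using assms by (simp add: dst_def)
qed

lemma dst_conj:
  assumes "x \<in> carrier G" "c \<in> carrier G" "p \<in> carrier G"
  shows "dst (p \<otimes> x \<otimes> inv p) (p \<otimes> c \<otimes> inv p) = dst x c"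
proof -
  have "inv p \<otimes> (p \<otimes> (c \<otimes> inv p)) = c \<otimes> inv p"
    using assms by (simp add: m_assoc[symmetric])
  then have "inv (p \<otimes> x \<otimes> inv p) \<otimes> (p \<otimes> c \<otimes> inv p) = p \<otimes> (inv x \<otimes> c) \<otimes> inv p"
    using assms by (simp add: inv_mult_group m_assoc)
  then show ?thesis
    using nrm_conj[of "inv x \<otimes> c" p] assms by (simp add: dst_def)
qed

end

section \<open>Non-principal ultrafilters and countable saturation\<close>

lemma nonprincipal_ultrafilter_le_sequentially:
  assumes "nonprincipal_ultrafilter (U :: nat filter)"
  shows "U \<le> sequentially"
proof -
  \<comment> \<open>If the complement of \<open>{i}\<close> were not in \<open>U\<close>, then
    \<open>{i}\<close> would be, and \<open>U\<close> would be principal at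
    \<open>i\<close>.\<close>
  have ne: "eventually (\<lambda>n. n \<noteq> i) U" for i
  proof (rule ccontr)
    assume "\<not> ?thesis"
    then have i: "eventually (\<lambda>n. n = i) U"
      using assms unfolding nonprincipal_ultrafilter_def ultrafilter_def by fastforce
    have "eventually P U \<longleftrightarrow> eventually P (principal {i})" for P
    proof
      assume "eventually P U"
      then have "eventually (\<lambda>n. n = i \<and> P n) U"
        using i by (simp add: eventually_conj)
      moreover have "U \<noteq> bot"
        using assms unfolding nonprincipal_ultrafilter_def ultrafilter_def by blast
      ultimately obtain n where "n = i \<and> P n"
        using eventually_happens by blast
      then show "eventually P (principal {i})"
        by (auto simp add: eventually_principal)
    next
      assume "eventually P (principal {i})"
      then show "eventually P U"
        using i by (auto simp: eventually_principal elim: eventually_mono)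
    qed
    then have "U = principal {i}" by (simp add: filter_eq_iff)
    then show False
      using assms unfolding nonprincipal_ultrafilter_def by blast
  qed
  have *: "eventually (\<lambda>n. n \<ge> N) U" for N
  proof -
    have "eventually (\<lambda>n. \<forall>i\<in>{..<N}. n \<noteq> i) U"
      using ne by (intro eventually_ball_finite) auto
    then show ?thesis
      by (rule eventually_mono) (metis lessThan_iff not_le)
  qed
  then show ?thesis
    by (intro filter_leI) (auto simp: eventually_sequentially intro: eventually_mono[OF *])
qed

text \<open>Countable saturation: \<open>h n\<close> satisfies as many of the first \<open>n\<close> conditions as possible.\<close>

lemma filter_saturation:
  assumes U: "U \<le> sequentially"
    and fin: "\<And>K. eventually (\<lambda>n. \<exists>x. \<forall>k\<le>K. P k n x) U"
  shows "\<exists>h. \<forall>k::nat. eventually (\<lambda>n. P k n (h n)) U"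
proof -
  \<comment> \<open>The bound \<open>K \<le> n\<close> keeps \<open>S n\<close> finite, so that
    \<open>Max\<close> makes sense. A fixed \<open>k\<close> still satisfies it for all large
    \<open>n\<close>, which suffices because \<open>U\<close> refines
    \<open>sequentially\<close>.\<close>
  define S where "S n = {K. K \<le> n \<and> (\<exists>x. \<forall>k\<le>K. P k n x)}" for n
  define h where "h n = (SOME x. \<forall>k\<le>Max (S n). P k n x)" for n
  have "eventually (\<lambda>n. P k n (h n)) U" for k
  proof -
    have "eventually (\<lambda>n. n \<ge> k) U"
      using U eventually_ge_at_top filter_leD by blast
    then show ?thesis
      using fin[of k]
    proof eventually_elim
      case (elim n)
      have fS: "finite (S n)"
        by (rule finite_subset[of _ "{..n}"]) (auto simp: S_def)
      have k: "k \<in> S n" using elim by (simp add: S_def)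
      have "Max (S n) \<in> S n" using Max_in[OF fS] k by blast
      then have "\<exists>x. \<forall>k\<le>Max (S n). P k n x" by (simp add: S_def)
      then have "\<forall>k\<le>Max (S n). P k n (h n)" unfolding h_def by (rule someI_ex)
      then show ?case using Max_ge[OF fS k] by blast
    qed
  qed
  then show ?thesis by blast
qed

text \<open>Supplies the two equal error bounds in triangle inequality arguments. Radii may be
  infinite, and then 1 serves as the half.\<close>

lemma ennreal_half_exists:
  assumes "(e::ennreal) > 0" obtains d where "d > 0" "d + d \<le> e"
proof (cases e)
  case (real r)
  then have "ennreal (r/2) > 0" "ennreal (r/2) + ennreal (r/2) \<le> e"
    using assms by (auto simp flip: ennreal_plus)
  then show ?thesis using that by blast
next
  case top
  then show ?thesis using that[of 1] by simp
qed

section \<open>The metric ultraproduct\<close>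

locale metric_group_sequence =
  fixes G :: "nat \<Rightarrow> 'a monoid"
    and nrm :: "nat \<Rightarrow> 'a \<Rightarrow> ennreal"
    and U :: "nat filter"
  assumes metric: "\<And>n. metric_group (G n) (nrm n)"
    and U: "nonprincipal_ultrafilter U"
begin

sublocale M: metric_group "G n" "nrm n" for n
  by (rule metric)

abbreviation P where "P \<equiv> product_group UNIV G"
abbreviation E where "E \<equiv> ultra_null G nrm U"
abbreviation Q where "Q \<equiv> metric_ultraproduct G nrm U"
abbreviation d where "d n \<equiv> metric_group.dst (G n) (nrm n)"

sublocale P: group P
  by (simp add: M.is_group)

lemma in_P: "x \<in> carrier P \<longleftrightarrow> (\<forall>n. x n \<in> carrier (G n))"
  by (auto simp: PiE_iff)

lemma P_mult: "(x \<otimes>\<^bsub>P\<^esub> y) n = x n \<otimes>\<^bsub>G n\<^esub> y n"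
  by simp

lemma P_inv: "x \<in> carrier P \<Longrightarrow> (inv\<^bsub>P\<^esub> x) n = inv\<^bsub>G n\<^esub> x n"
  using inv_product_group[of x UNIV G] by (simp add: M.is_group)

lemma P_one: "\<one>\<^bsub>P\<^esub> n = \<one>\<^bsub>G n\<^esub>"
  by simp

lemma P_cl: "x \<in> carrier P \<Longrightarrow> x n \<in> carrier (G n)"
  using in_P by blast

declare carrier_product_group [simp del] one_product_group [simp del] mult_product_group [simp del]
  inv_product_group [simp del]

lemma U_not_eventually: "\<not> eventually R U \<Longrightarrow> eventually (\<lambda>n. \<not> R n) U"
  using U unfolding nonprincipal_ultrafilter_def ultrafilter_def by blast

text \<open>This is where a case distinction made separately at each index becomes a single global
  one.\<close>

lemma U_disj: "eventually (\<lambda>n. R n \<or> S n) U \<Longrightarrow> eventually R U \<or> eventually S U"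
  using U_not_eventually[of S] eventually_elim2[of "\<lambda>n. R n \<or> S n" U "\<lambda>n. \<not> S n" R] by blast

lemma U_False: "\<not> eventually (\<lambda>n. False) U"
  using U unfolding nonprincipal_ultrafilter_def ultrafilter_def
  by (simp add: eventually_False)

lemma saturation:
  assumes "\<And>K. eventually (\<lambda>n. \<exists>x\<in>carrier (G n). \<forall>k\<le>K. R k n x) U"
  shows "\<exists>h\<in>carrier P. \<forall>k::nat. eventually (\<lambda>n. R k n (h n)) U"
proof -
  have "\<exists>h. \<forall>k. eventually (\<lambda>n. h n \<in> carrier (G n) \<and> R k n (h n)) U"
    by (rule filter_saturation[OF nonprincipal_ultrafilter_le_sequentially[OF U]])
      (rule eventually_mono[OF assms], auto)
  then obtain h where h: "\<And>k. eventually (\<lambda>n. h n \<in> carrier (G n) \<and> R k n (h n)) U"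
    by blast
  \<comment> \<open>The default value \<open>\<one>\<close> at the exceptional indices yields a
    genuine element of the product without affecting what holds \<open>U\<close>-eventually.\<close>
  define h' where "h' n = (if h n \<in> carrier (G n) then h n else \<one>\<^bsub>G n\<^esub>)" for n
  have "h' \<in> carrier P" by (simp add: in_P h'_def)
  moreover have "eventually (\<lambda>n. R k n (h' n)) U" for k
    using h[of k] by (rule eventually_mono) (simp add: h'_def)
  ultimately show ?thesis by blast
qed

text \<open>Saturation with the same condition for every \<open>k\<close> turns coordinatewise
  existence into a sequence in \<open>P\<close>.\<close>

lemma eventually_choice:
  assumes "eventually (\<lambda>n. \<exists>x\<in>carrier (G n). R n x) U"
  shows "\<exists>h\<in>carrier P. eventually (\<lambda>n. R n (h n)) U"
proof -
  have "eventually (\<lambda>n. \<exists>x\<in>carrier (G n). \<forall>k\<le>K. R n x) U" for K :: nat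
    using assms by (rule eventually_mono) blast
  then show ?thesis using saturation[of "\<lambda>_. R"] by blast
qed

lemma in_E: "x \<in> E \<longleftrightarrow> x \<in> carrier P \<and> (\<forall>e>0. eventually (\<lambda>n. nrm n (x n) < e) U)"
  unfolding ultra_null_def order_tendsto_iff by auto

lemma subgroup_E: "subgroup E P"
proof (rule P.subgroupI)
  show "E \<subseteq> carrier P" by (auto simp: in_E)
  have "\<one>\<^bsub>P\<^esub> \<in> E"
    unfolding in_E by (simp add: P_one M.nrm_one)
  then show "E \<noteq> {}" by blast
  show "inv\<^bsub>P\<^esub> x \<in> E" if "x \<in> E" for x
    using that by (auto simp: in_E P_inv P_cl M.nrm_inv)
  show "x \<otimes>\<^bsub>P\<^esub> y \<in> E" if x: "x \<in> E" and y: "y \<in> E" for x y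
    unfolding in_E
  proof (intro conjI allI impI)
    show "x \<otimes>\<^bsub>P\<^esub> y \<in> carrier P" using x y by (simp add: in_E)
    fix e :: ennreal assume "e > 0"
    then obtain \<delta> where \<delta>: "\<delta> > 0" "\<delta> + \<delta> \<le> e" by (rule ennreal_half_exists)
    have "eventually (\<lambda>n. nrm n (x n) < \<delta>) U" "eventually (\<lambda>n. nrm n (y n) < \<delta>) U"
      using x y \<delta> by (auto simp: in_E)
    then show "eventually (\<lambda>n. nrm n ((x \<otimes>\<^bsub>P\<^esub> y) n) < e) U"
    proof eventually_elim
      case (elim n)
      have "nrm n ((x \<otimes>\<^bsub>P\<^esub> y) n) \<le> nrm n (x n) + nrm n (y n)"
        using x y by (simp add: in_E P_cl P_mult M.nrm_mult_le)
      also have "\<dots> < \<delta> + \<delta>" using elim by (rule add_strict_mono)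
      finally show ?case using \<delta>(2) by (rule less_le_trans)
    qed
  qed
qed

lemma normal_E: "E \<lhd> P"
  unfolding P.normal_inv_iff
proof (intro conjI ballI)
  fix p x assume p: "p \<in> carrier P" and x: "x \<in> E"
  then have "nrm n ((p \<otimes>\<^bsub>P\<^esub> x \<otimes>\<^bsub>P\<^esub> inv\<^bsub>P\<^esub> p) n) = nrm n (x n)" for n
    by (simp add: in_E P_mult P_inv P_cl M.nrm_conj)
  then show "p \<otimes>\<^bsub>P\<^esub> x \<otimes>\<^bsub>P\<^esub> inv\<^bsub>P\<^esub> p \<in> E"
    using p x by (simp add: in_E)
qed (rule subgroup_E)

sublocale E: normal E P
  by (rule normal_E)

sublocale Q: group Q
  unfolding metric_ultraproduct_def by (rule E.factorgroup_is_group)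

sublocale quot: group_hom P Q "\<lambda>x. E #>\<^bsub>P\<^esub> x"
  using E.r_coset_hom_Mod Q.is_group
  by unfold_locales (simp add: metric_ultraproduct_def)

lemma carrier_Q: "carrier Q = (\<lambda>x. E #>\<^bsub>P\<^esub> x) ` carrier P"
  by (auto simp: metric_ultraproduct_def FactGroup_def RCOSETS_def)

lemma one_Q: "\<one>\<^bsub>Q\<^esub> = E"
  by (simp add: metric_ultraproduct_def FactGroup_def)

lemma coset_eqI:
  assumes x: "x \<in> carrier P" and y: "y \<in> carrier P"
    and e: "\<And>e. e > 0 \<Longrightarrow> eventually (\<lambda>n. d n (x n) (y n) < e) U"
  shows "E #>\<^bsub>P\<^esub> x = E #>\<^bsub>P\<^esub> y"
proof -
  have "inv\<^bsub>P\<^esub> x \<otimes>\<^bsub>P\<^esub> y \<in> E"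
    using x y e by (simp add: in_E P_mult P_inv M.dst_def)
  \<comment> \<open>Small distance places \<open>y\<close> in the left coset of \<open>x\<close>;
    normality of \<open>E\<close> turns it into the right coset used by the quotient.\<close>
  then have "x \<otimes>\<^bsub>P\<^esub> (inv\<^bsub>P\<^esub> x \<otimes>\<^bsub>P\<^esub> y) \<in> x <#\<^bsub>P\<^esub> E"
    by (auto simp: l_coset_def)
  moreover have "x \<otimes>\<^bsub>P\<^esub> (inv\<^bsub>P\<^esub> x \<otimes>\<^bsub>P\<^esub> y) = y"
    using x y by (simp add: P.m_assoc[symmetric])
  ultimately have "y \<in> E #>\<^bsub>P\<^esub> x" using E.coset_eq x by simp
  then show ?thesis using P.repr_independence x subgroup_E by blast
qed

lemma coset_eventually_eq:
  assumes "x \<in> carrier P" "y \<in> carrier P" "eventually (\<lambda>n. x n = y n) U"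
  shows "E #>\<^bsub>P\<^esub> x = E #>\<^bsub>P\<^esub> y"
  using assms by (intro coset_eqI) (auto simp: M.dst_self P_cl elim!: eventually_mono)

section \<open>Closeness to products of conjugates\<close>

text \<open>The distance from \<open>x n\<close> to the products of at most \<open>N\<close>
  conjugates tends to 0 along \<open>U\<close>, phrased without an infimum. On representatives it
  stands for membership of the class of \<open>x\<close> in \<open>D\<^sub>N\<close>.\<close>

definition near :: "(nat \<Rightarrow> 'a) \<Rightarrow> nat \<Rightarrow> (nat \<Rightarrow> 'a) \<Rightarrow> bool" where
  "near g N x \<longleftrightarrow> (\<forall>e>0. eventually (\<lambda>n. \<exists>c\<in>conj_products N (g n) (G n). d n (x n) c < e) U)"

lemma nearD:
  "\<lbrakk>near g N x; e > 0\<rbrakk> \<Longrightarrow> eventually (\<lambda>n. \<exists>c\<in>conj_products N (g n) (G n). d n (x n) c < e) U"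
  by (simp add: near_def)

text \<open>Along an ultrafilter the failure of \<open>eventually\<close> is again an
  \<open>eventually\<close>, so one positive \<open>e\<close> works at \<open>U\<close>-almost all
  indices.\<close>

lemma not_nearD:
  assumes "\<not> near g N x"
  obtains e where "e > 0" "eventually (\<lambda>n. \<forall>c\<in>conj_products N (g n) (G n). e \<le> d n (x n) c) U"
  using assms U_not_eventually unfolding near_def by (force simp: not_less)

lemma conj_products_in_carrier:
  "\<lbrakk>g \<in> carrier P; c \<in> conj_products N (g n) (G n)\<rbrakk> \<Longrightarrow> c \<in> carrier (G n)"
  using M.conj_products_subset[OF P_cl] by blast

lemma near_eventually_mem:
  assumes "x \<in> carrier P" "eventually (\<lambda>n. x n \<in> conj_products N (g n) (G n)) U"
  shows "near g N x"
  using assms unfolding near_def by (auto simp: M.dst_self P_cl elim!: eventually_mono intro!: bexI)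

text \<open>With no factors the only product is the identity, at distance
  \<open>nrm n (x n)\<close>. Thus elements of \<open>E\<close> can be absorbed without raising
  \<open>N\<close>.\<close>

lemma near_E:
  assumes "x \<in> E" shows "near g 0 x"
  unfolding near_def
proof (intro allI impI)
  fix e :: ennreal assume "e > 0"
  then have "eventually (\<lambda>n. nrm n (x n) < e) U" using assms by (simp add: in_E)
  then show "eventually (\<lambda>n. \<exists>c\<in>conj_products 0 (g n) (G n). d n (x n) c < e) U"
    using assms by (auto simp: conj_products_0 M.dst_def in_E P_cl M.nrm_inv elim!: eventually_mono)
qed

lemma near_gen:
  assumes g: "g \<in> carrier P" shows "near g (Suc 0) g"
proof (rule near_eventually_mem[OF g], rule always_eventually, rule allI)
  fix n
  have "g n \<in> conjugates (G n) (g n)"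
    unfolding conjugates_def using P_cl[OF g, of n] by (auto intro!: exI[of _ "\<one>\<^bsub>G n\<^esub>"])
  then have "g n \<otimes>\<^bsub>G n\<^esub> \<one>\<^bsub>G n\<^esub> \<in> conj_products (Suc 0) (g n) (G n)"
    unfolding conj_products_Suc conj_products_0 by blast
  then show "g n \<in> conj_products (Suc 0) (g n) (G n)"
    using P_cl[OF g] by simp
qed

text \<open>Approximating products are concatenated: by \<open>dst_mult\<close> the errors add, and
  so do the lengths.\<close>

lemma near_mult:
  assumes g: "g \<in> carrier P" and x: "x \<in> carrier P" "near g M x" and y: "y \<in> carrier P" "near g N y"
  shows "near g (M + N) (x \<otimes>\<^bsub>P\<^esub> y)"
  unfolding near_def
proof (intro allI impI)
  fix e :: ennreal assume "e > 0"
  then obtain \<delta> where \<delta>: "\<delta> > 0" "\<delta> + \<delta> \<le> e" by (rule ennreal_half_exists)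
  show "eventually (\<lambda>n. \<exists>c\<in>conj_products (M + N) (g n) (G n). d n ((x \<otimes>\<^bsub>P\<^esub> y) n) c < e) U"
    using nearD[OF x(2) \<delta>(1)] nearD[OF y(2) \<delta>(1)]
  proof eventually_elim
    case (elim n)
    then obtain c c' where c: "c \<in> conj_products M (g n) (G n)" "d n (x n) c < \<delta>"
      and c': "c' \<in> conj_products N (g n) (G n)" "d n (y n) c' < \<delta>" by blast
    have "d n (x n \<otimes>\<^bsub>G n\<^esub> y n) (c \<otimes>\<^bsub>G n\<^esub> c') \<le> d n (x n) c + d n (y n) c'"
      using x y c c' by (intro M.dst_mult) (auto intro: P_cl conj_products_in_carrier[OF g])
    also have "\<dots> < \<delta> + \<delta>" using c c' by (intro add_strict_mono)
    finally have "d n ((x \<otimes>\<^bsub>P\<^esub> y) n) (c \<otimes>\<^bsub>G n\<^esub> c') < e"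
      using \<delta>(2) by (simp add: P_mult)
    then show ?case using M.conj_products_mult[OF P_cl[OF g] c(1) c'(1)] by blast
  qed
qed

lemma near_inv:
  assumes g: "g \<in> carrier P" and x: "x \<in> carrier P" "near g N x"
  shows "near g N (inv\<^bsub>P\<^esub> x)"
  unfolding near_def
proof (intro allI impI)
  fix e :: ennreal assume "e > 0"
  show "eventually (\<lambda>n. \<exists>c\<in>conj_products N (g n) (G n). d n ((inv\<^bsub>P\<^esub> x) n) c < e) U"
    using nearD[OF x(2) \<open>e > 0\<close>]
  proof eventually_elim
    case (elim n)
    then obtain c where c: "c \<in> conj_products N (g n) (G n)" "d n (x n) c < e" by blast
    then have "d n ((inv\<^bsub>P\<^esub> x) n) (inv\<^bsub>G n\<^esub> c) < e"
      using x by (simp add: P_inv P_cl M.dst_inv conj_products_in_carrier[OF g])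
    then show ?case using M.conj_products_inv[OF P_cl[OF g] c(1)] by blast
  qed
qed

lemma near_conj:
  assumes g: "g \<in> carrier P" and x: "x \<in> carrier P" "near g N x" and p: "p \<in> carrier P"
  shows "near g N (p \<otimes>\<^bsub>P\<^esub> x \<otimes>\<^bsub>P\<^esub> inv\<^bsub>P\<^esub> p)"
  unfolding near_def
proof (intro allI impI)
  fix e :: ennreal assume "e > 0"
  show "eventually (\<lambda>n. \<exists>c\<in>conj_products N (g n) (G n). d n ((p \<otimes>\<^bsub>P\<^esub> x \<otimes>\<^bsub>P\<^esub> inv\<^bsub>P\<^esub> p) n) c < e) U"
    using nearD[OF x(2) \<open>e > 0\<close>]
  proof eventually_elim
    case (elim n)
    then obtain c where c: "c \<in> conj_products N (g n) (G n)" "d n (x n) c < e" by blast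
    then have "d n ((p \<otimes>\<^bsub>P\<^esub> x \<otimes>\<^bsub>P\<^esub> inv\<^bsub>P\<^esub> p) n) (p n \<otimes>\<^bsub>G n\<^esub> c \<otimes>\<^bsub>G n\<^esub> inv\<^bsub>G n\<^esub> p n) < e"
      using x p by (simp add: P_mult P_inv P_cl M.dst_conj conj_products_in_carrier[OF g])
    then show ?case using M.conj_products_conj[OF P_cl[OF g] P_cl[OF p] c(1)] by blast
  qed
qed

section \<open>From closeness in the factors to products of conjugates in the quotient\<close>

lemma coset_in_conj_products:
  assumes g: "g \<in> carrier P"
  shows "\<lbrakk>c \<in> carrier P; eventually (\<lambda>n. c n \<in> conj_products N (g n) (G n)) U\<rbrakk>
    \<Longrightarrow> E #>\<^bsub>P\<^esub> c \<in> conj_products N (E #>\<^bsub>P\<^esub> g) Q"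
\<comment> \<open>The factorisations of \<open>c n\<close> may differ in length and signs from index
  to index, so one factor is peeled off at a time and the ultrafilter decides its type.\<close>
proof (induction N arbitrary: c)
  case 0
  then have "E #>\<^bsub>P\<^esub> c = E #>\<^bsub>P\<^esub> \<one>\<^bsub>P\<^esub>"
    by (intro coset_eventually_eq) (auto simp: conj_products_0 P_one)
  then show ?case by (simp add: conj_products_0)
next
  case (Suc N)
  \<comment> \<open>\<open>?A n u a\<close>: the element \<open>a\<close> is a conjugate of
    \<open>u\<close> followed by at most \<open>N\<close> further factors. In \<open>step\<close>
    below, \<open>u\<close> represents \<open>g\<close> or its inverse, so both signs are treated at
    once.\<close>
  let ?A = "\<lambda>n u a. \<exists>z\<in>conj_products N (g n) (G n). \<exists>h\<in>carrier (G n).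
    a = h \<otimes>\<^bsub>G n\<^esub> u \<otimes>\<^bsub>G n\<^esub> inv\<^bsub>G n\<^esub> h \<otimes>\<^bsub>G n\<^esub> z"
  have step: "E #>\<^bsub>P\<^esub> c \<in> conj_products (Suc N) (E #>\<^bsub>P\<^esub> g) Q"
    if u: "u \<in> carrier P" "E #>\<^bsub>P\<^esub> u \<in> {E #>\<^bsub>P\<^esub> g, inv\<^bsub>Q\<^esub> (E #>\<^bsub>P\<^esub> g)}"
      and ev: "eventually (\<lambda>n. ?A n (u n) (c n)) U" for u
  proof -
    \<comment> \<open>The remainders and then the conjugators are chosen coordinatewise, so that the
      factorisation becomes one in \<open>P\<close> up to \<open>U\<close>-eventual
      equality.\<close>
    have "eventually (\<lambda>n. \<exists>z\<in>carrier (G n). z \<in> conj_products N (g n) (G n) \<and>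
        (\<exists>h\<in>carrier (G n). c n = h \<otimes>\<^bsub>G n\<^esub> u n \<otimes>\<^bsub>G n\<^esub> inv\<^bsub>G n\<^esub> h \<otimes>\<^bsub>G n\<^esub> z)) U"
      using ev by (rule eventually_mono) (use conj_products_in_carrier[OF g] in blast)
    from eventually_choice[OF this] obtain z where z: "z \<in> carrier P" and z': "eventually (\<lambda>n. z n \<in> conj_products N (g n) (G n) \<and>
        (\<exists>h\<in>carrier (G n). c n = h \<otimes>\<^bsub>G n\<^esub> u n \<otimes>\<^bsub>G n\<^esub> inv\<^bsub>G n\<^esub> h \<otimes>\<^bsub>G n\<^esub> z n)) U"
      by blast
    then obtain h where h: "h \<in> carrier P"
      and h': "eventually (\<lambda>n. c n = h n \<otimes>\<^bsub>G n\<^esub> u n \<otimes>\<^bsub>G n\<^esub> inv\<^bsub>G n\<^esub> h n \<otimes>\<^bsub>G n\<^esub> z n) U"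
      using eventually_choice[of "\<lambda>n h. c n = h \<otimes>\<^bsub>G n\<^esub> u n \<otimes>\<^bsub>G n\<^esub> inv\<^bsub>G n\<^esub> h \<otimes>\<^bsub>G n\<^esub> z n"]
      unfolding eventually_conj_iff by blast
    have "E #>\<^bsub>P\<^esub> c = E #>\<^bsub>P\<^esub> (h \<otimes>\<^bsub>P\<^esub> u \<otimes>\<^bsub>P\<^esub> inv\<^bsub>P\<^esub> h \<otimes>\<^bsub>P\<^esub> z)"
      using h' h z u Suc.prems
      by (intro coset_eventually_eq) (auto simp: P_mult P_inv in_P)
    also have "\<dots> = ((E #>\<^bsub>P\<^esub> h) \<otimes>\<^bsub>Q\<^esub> (E #>\<^bsub>P\<^esub> u) \<otimes>\<^bsub>Q\<^esub> inv\<^bsub>Q\<^esub> (E #>\<^bsub>P\<^esub> h)) \<otimes>\<^bsub>Q\<^esub> (E #>\<^bsub>P\<^esub> z)"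
      using h z u by simp
    finally have eq: "E #>\<^bsub>P\<^esub> c = \<dots>" .
    have "(E #>\<^bsub>P\<^esub> h) \<otimes>\<^bsub>Q\<^esub> (E #>\<^bsub>P\<^esub> u) \<otimes>\<^bsub>Q\<^esub> inv\<^bsub>Q\<^esub> (E #>\<^bsub>P\<^esub> h) \<in> conjugates Q (E #>\<^bsub>P\<^esub> u)"
      unfolding conjugates_def using quot.hom_closed[OF h] by blast
    then have "(E #>\<^bsub>P\<^esub> h) \<otimes>\<^bsub>Q\<^esub> (E #>\<^bsub>P\<^esub> u) \<otimes>\<^bsub>Q\<^esub> inv\<^bsub>Q\<^esub> (E #>\<^bsub>P\<^esub> h)
        \<in> conjugates Q (E #>\<^bsub>P\<^esub> g) \<union> conjugates Q (inv\<^bsub>Q\<^esub> (E #>\<^bsub>P\<^esub> g))"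
      using u(2) by (metis UnI1 UnI2 insertE singletonD)
    moreover have "E #>\<^bsub>P\<^esub> z \<in> conj_products N (E #>\<^bsub>P\<^esub> g) Q"
      using z' by (intro Suc.IH z) (simp add: eventually_conj_iff)
    ultimately show ?thesis unfolding conj_products_Suc eq by blast
  qed
  \<comment> \<open>At each index there is no factor, or the first one is a conjugate of
    \<open>g n\<close> or of its inverse; \<open>U_disj\<close> selects one alternative for
    \<open>U\<close>-almost all \<open>n\<close>.\<close>
  have "eventually (\<lambda>n. c n = \<one>\<^bsub>G n\<^esub> \<or> ?A n (g n) (c n) \<or> ?A n (inv\<^bsub>G n\<^esub> g n) (c n)) U"
    using Suc.prems(2) by (rule eventually_mono) (unfold conj_products_Suc conjugates_def, blast)
  from U_disj[OF this] consider "eventually (\<lambda>n. c n = \<one>\<^bsub>G n\<^esub>) U" | "eventually (\<lambda>n. ?A n (g n) (c n)) U"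
    | "eventually (\<lambda>n. ?A n (inv\<^bsub>G n\<^esub> g n) (c n)) U"
    using U_disj[of "\<lambda>n. ?A n (g n) (c n)" "\<lambda>n. ?A n (inv\<^bsub>G n\<^esub> g n) (c n)"] by blast
  then show ?case
  proof cases
    case 1
    then have "E #>\<^bsub>P\<^esub> c = E #>\<^bsub>P\<^esub> \<one>\<^bsub>P\<^esub>"
      using Suc.prems by (intro coset_eventually_eq) (auto simp: P_one)
    then show ?thesis by (simp add: one_in_conj_products)
  next
    case 2
    then show ?thesis using step[of g] g by blast
  next
    case 3
    then show ?thesis using step[of "inv\<^bsub>P\<^esub> g"] g by (simp add: P_inv)
  qed
qed

text \<open>Saturation attains the infimum: some \<open>y\<close> consists of exact products
  coordinatewise and is infinitely close to \<open>x\<close>, hence has the same class.\<close>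

lemma near_imp_coset_in_conj_products:
  assumes g: "g \<in> carrier P" and x: "x \<in> carrier P" "near g N x"
  shows "E #>\<^bsub>P\<^esub> x \<in> conj_products N (E #>\<^bsub>P\<^esub> g) Q"
proof -
  let ?e = "\<lambda>k. ennreal (1 / Suc k)"
  let ?R = "\<lambda>k n y. y \<in> conj_products N (g n) (G n) \<and> d n (x n) y < ?e k"
  \<comment> \<open>The tolerances decrease with \<open>k\<close>, so a witness for \<open>K\<close>
    satisfies all earlier conditions.\<close>
  have "eventually (\<lambda>n. \<exists>y\<in>carrier (G n). \<forall>k\<le>K. ?R k n y) U" for K
  proof -
    have "?e K > 0" by simp
    from nearD[OF x(2) this] show ?thesis
    proof eventually_elim
      case (elim n)
      then obtain c where c: "c \<in> conj_products N (g n) (G n)" "d n (x n) c < ?e K" by blast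
      have "d n (x n) c < ?e k" if "k \<le> K" for k
      proof -
        have "?e K \<le> ?e k" using that by (intro ennreal_leI) (simp add: frac_le)
        then show ?thesis using c(2) by (rule less_le_trans[rotated])
      qed
      then show ?case using c conj_products_in_carrier[OF g] by blast
    qed
  qed
  then obtain y where y: "y \<in> carrier P" and R: "\<And>k. eventually (\<lambda>n. ?R k n (y n)) U"
    using saturation[of ?R] by blast
  have "E #>\<^bsub>P\<^esub> x = E #>\<^bsub>P\<^esub> y"
  proof (rule coset_eqI[OF x(1) y])
    fix e :: ennreal assume e: "e > 0"
    obtain k where k: "?e k < e"
    proof (cases e)
      case (real r)
      then obtain k where "1 / real (Suc k) < r"
        using e nat_approx_posE[of r] by auto
      then show ?thesis using that[of k] real by (simp add: ennreal_less_iff)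
    next
      case top
      then show ?thesis using that[of 0] by simp
    qed
    show "eventually (\<lambda>n. d n (x n) (y n) < e) U"
      using R[of k] by (rule eventually_mono) (use k in auto)
  qed
  moreover have "E #>\<^bsub>P\<^esub> y \<in> conj_products N (E #>\<^bsub>P\<^esub> g) Q"
    using R[of 0] by (intro coset_in_conj_products[OF g y]) (simp add: eventually_conj_iff)
  ultimately show ?thesis by simp
qed

section \<open>Simplicity and the uniform bound on the number of factors\<close>

lemma is_simple_imp_near:
  assumes simp: "is_simple Q" and g: "g \<in> carrier P" "g \<notin> E" and x: "x \<in> carrier P"
  shows "\<exists>N. near g N x"
proof -
  \<comment> \<open>\<open>H\<close> is normal and contains \<open>g\<close>. Its image under the
    surjection onto \<open>Q\<close> is normal and, as \<open>g\<close> is not in \<open>E\<close>,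
    non-trivial; simplicity makes it all of \<open>Q\<close>.\<close>
  define H where "H = {x \<in> carrier P. \<exists>N. near g N x}"
  have "H \<lhd> P"
    unfolding P.normal_inv_iff
  proof (intro conjI ballI)
    show "subgroup H P"
    proof (rule P.subgroupI)
      show "H \<noteq> {}" using g near_gen unfolding H_def by blast
      show "a \<otimes>\<^bsub>P\<^esub> b \<in> H" if "a \<in> H" "b \<in> H" for a b
        using that near_mult[OF g(1)] unfolding H_def by blast
      show "inv\<^bsub>P\<^esub> a \<in> H" if "a \<in> H" for a
        using that near_inv[OF g(1)] unfolding H_def by blast
    qed (auto simp: H_def)
    show "p \<otimes>\<^bsub>P\<^esub> a \<otimes>\<^bsub>P\<^esub> inv\<^bsub>P\<^esub> p \<in> H" if "p \<in> carrier P" "a \<in> H" for p a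
      using that near_conj[OF g(1)] unfolding H_def by blast
  qed
  then have "(\<lambda>x. E #>\<^bsub>P\<^esub> x) ` H \<lhd> Q"
    by (rule normal.surj_hom_normal_subgroup[OF _ quot.group_hom_axioms]) (simp add: carrier_Q)
  then consider "(\<lambda>x. E #>\<^bsub>P\<^esub> x) ` H = {\<one>\<^bsub>Q\<^esub>}" | "(\<lambda>x. E #>\<^bsub>P\<^esub> x) ` H = carrier Q"
    using simp unfolding is_simple_def by blast
  then show ?thesis
  proof cases
    case 1
    have "g \<in> H" using g near_gen unfolding H_def by blast
    then have "E #>\<^bsub>P\<^esub> g = E" using 1 one_Q by blast
    then show ?thesis using g P.coset_join1 subgroup_E by blast
  next
    case 2
    then obtain y where y: "y \<in> H" "E #>\<^bsub>P\<^esub> x = E #>\<^bsub>P\<^esub> y"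
      using x carrier_Q by blast
    then obtain N where N: "near g N y" and yP: "y \<in> carrier P" unfolding H_def by blast
    \<comment> \<open>Equality of classes gives \<open>x\<close> only up to a left factor in
      \<open>E\<close>, which \<open>near_E\<close> absorbs with 0 factors.\<close>
    have "x \<in> E #>\<^bsub>P\<^esub> y" using P.rcos_self[OF x subgroup_E] y by simp
    then obtain a where a: "a \<in> E" "x = a \<otimes>\<^bsub>P\<^esub> y" by (auto simp: r_coset_def)
    then have "near g (0 + N) x" using near_mult[OF g(1) _ near_E[OF a(1)] yP N] by (simp add: in_E)
    then show ?thesis by blast
  qed
qed

text \<open>Since \<open>b\<close> is the product of the inverse of \<open>h\<close> with
  \<open>h b\<close>, this moves a ball around \<open>h\<close> to the identity at the cost of
  doubling \<open>N\<close>.\<close>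

lemma near_of_coset_mult:
  assumes "g \<in> carrier P" "h \<in> carrier P" "b \<in> carrier P"
    and "near g N h" "near g N (h \<otimes>\<^bsub>P\<^esub> b)"
  shows "near g (N + N) b"
proof -
  have "inv\<^bsub>P\<^esub> h \<otimes>\<^bsub>P\<^esub> (h \<otimes>\<^bsub>P\<^esub> b) = b"
    using assms by (simp add: P.m_assoc[symmetric])
  then show ?thesis
    using near_mult[OF assms(1) _ near_inv[OF assms(1,2,4)] _ assms(5)] assms(2,3) by simp
qed

text \<open>
  The Baire category argument: if no set \<open>near g N\<close> contains a ball around the identity, then there
  is a decreasing sequence of balls, the \<open>K\<close>-th one staying away from \<open>near g K\<close>, and saturation
  takes the place of completeness in providing a common point.
\<close>

lemma near_contains_ball:
  assumes g: "g \<in> carrier P" and near: "\<And>x. x \<in> carrier P \<Longrightarrow> \<exists>N. near g N x"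
  shows "\<exists>N. \<exists>r>0. \<forall>b\<in>carrier P. eventually (\<lambda>n. nrm n (b n) < r) U \<longrightarrow> near g N b"
proof (rule ccontr)
  assume "\<not> ?thesis"
  then have small: "\<exists>b\<in>carrier P. eventually (\<lambda>n. nrm n (b n) < r) U \<and> \<not> near g N b" if "r > 0" for r N
    using that by blast
  \<comment> \<open>The doubled radius is a safety margin: by the triangle inequality, points within
    \<open>\<delta>\<close> of \<open>h\<close> stay at least \<open>\<delta>\<close> away from the
    products of length at most \<open>K\<close>.\<close>
  define far where "far K h \<delta> \<longleftrightarrow> h \<in> carrier P \<and> \<delta> > 0 \<and>
      eventually (\<lambda>n. \<forall>c\<in>conj_products K (g n) (G n). \<delta> + \<delta> \<le> d n (h n) c) U"
    for K and h :: "nat \<Rightarrow> 'a" and \<delta> :: ennreal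
  \<comment> \<open>Inclusion of the ball around \<open>h'\<close> in the ball around
    \<open>h\<close>, at \<open>U\<close>-almost all indices.\<close>
  define sub where "sub h \<delta> h' \<delta>' \<longleftrightarrow>
      eventually (\<lambda>n. \<forall>y\<in>carrier (G n). d n (h' n) y < \<delta>' \<longrightarrow> d n (h n) y < \<delta>) U"
    for h h' :: "nat \<Rightarrow> 'a" and \<delta> \<delta>' :: ennreal
  have refine: "\<exists>h' \<delta>'. far K h' \<delta>' \<and> sub h \<delta> h' \<delta>'"
    if h: "h \<in> carrier P" and \<delta>: "\<delta> > 0" for K h \<delta>
  proof -
    obtain \<eta> where \<eta>: "\<eta> > 0" "\<eta> + \<eta> \<le> \<delta>" using \<delta> by (rule ennreal_half_exists)
    obtain h' where h': "h' \<in> carrier P" "\<not> near g K h'" "eventually (\<lambda>n. d n (h n) (h' n) < \<eta>) U"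
    \<comment> \<open>If \<open>h\<close> is near, it is moved by a small \<open>b\<close> that is
      not near at level \<open>K + K\<close>; by \<open>near_of_coset_mult\<close> the moved point
      is not near at level \<open>K\<close>. Otherwise \<open>h\<close> itself serves.\<close>
    proof (cases "near g K h")
      case True
      obtain b where b: "b \<in> carrier P" "eventually (\<lambda>n. nrm n (b n) < \<eta>) U" "\<not> near g (K + K) b"
        using small[OF \<eta>(1)] by blast
      have "inv\<^bsub>G n\<^esub> h n \<otimes>\<^bsub>G n\<^esub> (h n \<otimes>\<^bsub>G n\<^esub> b n) = b n" for n
        using P_cl[OF h] P_cl[OF b(1)] by (simp add: M.m_assoc[symmetric])
      then have "d n (h n) ((h \<otimes>\<^bsub>P\<^esub> b) n) = nrm n (b n)" for n
        by (simp add: M.dst_def P_mult)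
      then show ?thesis
        using that[of "h \<otimes>\<^bsub>P\<^esub> b"] near_of_coset_mult[OF g h b(1) True] b h by auto
    next
      case False
      then show ?thesis using that[of h] h \<eta> by (simp add: M.dst_self P_cl)
    qed
    obtain e where e: "e > 0" "eventually (\<lambda>n. \<forall>c\<in>conj_products K (g n) (G n). e \<le> d n (h' n) c) U"
      using h'(2) by (rule not_nearD)
    obtain \<mu> where \<mu>: "\<mu> > 0" "\<mu> + \<mu> \<le> e" using e(1) by (rule ennreal_half_exists)
    \<comment> \<open>In the new radius, \<open>\<eta>\<close> secures inclusion in the old ball and
      \<open>\<mu>\<close> the safety margin.\<close>
    have "min \<eta> \<mu> + min \<eta> \<mu> \<le> \<mu> + \<mu>" by (intro add_mono) auto
    with \<mu>(2) have "min \<eta> \<mu> + min \<eta> \<mu> \<le> e" by order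
    then have "eventually (\<lambda>n. \<forall>c\<in>conj_products K (g n) (G n). min \<eta> \<mu> + min \<eta> \<mu> \<le> d n (h' n) c) U"
      using e(2) by (auto elim!: eventually_mono intro: order_trans)
    then have "far K h' (min \<eta> \<mu>)"
      using h' \<eta> \<mu> by (simp add: far_def)
    moreover have "sub h \<delta> h' (min \<eta> \<mu>)"
      unfolding sub_def using h'(3)
    proof eventually_elim
      case (elim n)
      show ?case
      proof (intro ballI impI)
        fix y assume y: "y \<in> carrier (G n)" "d n (h' n) y < min \<eta> \<mu>"
        have "d n (h n) y \<le> d n (h n) (h' n) + d n (h' n) y"
          using y P_cl[OF h] P_cl[OF h'(1)] by (intro M.dst_triangle)
        also have "\<dots> < \<eta> + \<eta>" using elim y by (intro add_strict_mono) auto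
        finally show "d n (h n) y < \<delta>" using \<eta>(2) by (rule less_le_trans)
      qed
    qed
    ultimately show ?thesis by blast
  qed
  have "\<exists>f. \<forall>K. far K (fst (f K)) (snd (f K)) \<and>
      sub (fst (f K)) (snd (f K)) (fst (f (Suc K))) (snd (f (Suc K)))"
  proof (rule dependent_nat_choice)
    show "\<exists>p. far 0 (fst p) (snd p)" using refine[of "\<one>\<^bsub>P\<^esub>" 1 0] by force
    show "\<exists>q. far (Suc K) (fst q) (snd q) \<and> sub (fst p) (snd p) (fst q) (snd q)"
      if "far K (fst p) (snd p)" for p K
      using refine[of "fst p" "snd p" "Suc K"] that by (force simp: far_def)
  qed
  then obtain f where f: "\<And>K. far K (fst (f K)) (snd (f K))"
    "\<And>K. sub (fst (f K)) (snd (f K)) (fst (f (Suc K))) (snd (f (Suc K)))" by blast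
  define h where "h K = fst (f K)" for K
  define \<delta> where "\<delta> K = snd (f K)" for K
  have hP: "h K \<in> carrier P" and \<delta>_pos: "\<delta> K > 0" and
    far: "eventually (\<lambda>n. \<forall>c\<in>conj_products K (g n) (G n). \<delta> K + \<delta> K \<le> d n (h K n) c) U" for K
    using f(1)[of K] by (auto simp: far_def h_def \<delta>_def)
  have nested: "sub (h k) (\<delta> k) (h K) (\<delta> K)" if "k \<le> K" for k K
    using that
  proof (induction K rule: dec_induct)
    case base
    then show ?case by (simp add: sub_def)
  next
    case (step K)
    then show ?case
      using f(2)[of K] unfolding sub_def h_def \<delta>_def by (auto elim: eventually_elim2)
  qed
  \<comment> \<open>The centre of the \<open>K\<close>-th ball lies in all earlier balls, which is
    the finite satisfiability that saturation requires.\<close>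
  have "eventually (\<lambda>n. \<exists>x\<in>carrier (G n). \<forall>k\<le>K. d n (h k n) x < \<delta> k) U" for K
  proof -
    have "eventually (\<lambda>n. d n (h k n) (h K n) < \<delta> k) U" if "k \<le> K" for k
      using nested[OF that] unfolding sub_def
      by (rule eventually_mono) (simp add: P_cl[OF hP] M.dst_self \<delta>_pos)
    then have "eventually (\<lambda>n. \<forall>k\<in>{..K}. d n (h k n) (h K n) < \<delta> k) U"
      by (intro eventually_ball_finite) auto
    then show ?thesis
      by (rule eventually_mono) (use P_cl[OF hP] in auto)
  qed
  then obtain x where x: "x \<in> carrier P" and close: "\<And>k. eventually (\<lambda>n. d n (h k n) (x n) < \<delta> k) U"
    using saturation[of "\<lambda>k n x. d n (h k n) x < \<delta> k"] by blast
  obtain N where "near g N x" using near x by blast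
  \<comment> \<open>The common point lies in the \<open>N\<close>-th ball and also within
    \<open>\<delta> N\<close> of a product of length at most \<open>N\<close>, against the safety
    margin.\<close>
  from nearD[OF this \<delta>_pos[of N]] close[of N] far[of N] have "eventually (\<lambda>n. False) U"
  proof eventually_elim
    case (elim n)
    then obtain c where c: "c \<in> conj_products N (g n) (G n)" "d n (x n) c < \<delta> N" by blast
    have "d n (h N n) c \<le> d n (h N n) (x n) + d n (x n) c"
      using P_cl[OF hP] P_cl[OF x] conj_products_in_carrier[OF g c(1)] by (intro M.dst_triangle)
    also have "\<dots> < \<delta> N + \<delta> N" using elim c by (intro add_strict_mono) auto
    finally show ?case using elim c by (meson leD)
  qed
  then show False using U_False by blast
qed

text \<open>Non-nearness alone gives separations that may shrink with \<open>N\<close> and be lost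
  under saturation; the ball makes one \<open>r\<close> serve for all \<open>N\<close>.\<close>

lemma near_uniform:
  assumes g: "g \<in> carrier P" and near: "\<And>x. x \<in> carrier P \<Longrightarrow> \<exists>N. near g N x"
  shows "\<exists>N. \<forall>x\<in>carrier P. near g N x"
proof (rule ccontr)
  assume "\<not> ?thesis"
  then have "\<forall>N. \<exists>x\<in>carrier P. \<not> near g N x" by blast
  then obtain X where X: "\<And>N. X N \<in> carrier P" "\<And>N. \<not> near g N (X N)" by metis
  obtain M r where r: "r > 0"
    and ball: "\<And>b. \<lbrakk>b \<in> carrier P; eventually (\<lambda>n. nrm n (b n) < r) U\<rbrakk> \<Longrightarrow> near g M b"
    using near_contains_ball[OF g near] by blast
  \<comment> \<open>A product \<open>c\<close> of length \<open>N\<close> within \<open>r\<close> of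
    \<open>X (N + M)\<close> would leave a quotient in the ball, hence near at level
    \<open>M\<close>; multiplying back by \<open>c\<close> would make \<open>X (N + M)\<close> near
    at level \<open>N + M\<close>.\<close>
  have far: "eventually (\<lambda>n. \<forall>c\<in>conj_products N (g n) (G n). r \<le> d n (X (N + M) n) c) U" for N
  proof (rule ccontr)
    let ?x = "X (N + M)"
    assume "\<not> ?thesis"
    then have "eventually (\<lambda>n. \<exists>c\<in>carrier (G n). c \<in> conj_products N (g n) (G n) \<and> d n (?x n) c < r) U"
      by (rule eventually_mono[OF U_not_eventually]) (use conj_products_in_carrier[OF g] in \<open>auto simp: not_le\<close>)
    from eventually_choice[OF this] obtain c where c: "c \<in> carrier P"
      and c': "eventually (\<lambda>n. c n \<in> conj_products N (g n) (G n)) U" "eventually (\<lambda>n. d n (?x n) (c n) < r) U"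
      unfolding eventually_conj_iff by blast
    have "nrm n ((inv\<^bsub>P\<^esub> c \<otimes>\<^bsub>P\<^esub> ?x) n) = d n (?x n) (c n)" for n
      using c X(1) M.dst_commute[of "?x n" n "c n"] by (simp add: P_mult P_inv P_cl M.dst_def)
    then have "near g M (inv\<^bsub>P\<^esub> c \<otimes>\<^bsub>P\<^esub> ?x)"
      using c c' X(1) by (intro ball) auto
    then have "near g (N + M) (c \<otimes>\<^bsub>P\<^esub> (inv\<^bsub>P\<^esub> c \<otimes>\<^bsub>P\<^esub> ?x))"
      using c X(1) by (intro near_mult[OF g c near_eventually_mem[OF c c'(1)]]) auto
    moreover have "c \<otimes>\<^bsub>P\<^esub> (inv\<^bsub>P\<^esub> c \<otimes>\<^bsub>P\<^esub> ?x) = ?x"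
      using c X(1) by (simp add: P.m_assoc[symmetric])
    ultimately show False using X(2) by simp
  qed
  \<comment> \<open>The sets of products grow with their length, so \<open>X (K + M)\<close> meets
    all conditions up to \<open>K\<close>.\<close>
  have "eventually (\<lambda>n. \<exists>x\<in>carrier (G n). \<forall>k\<le>K. \<forall>c\<in>conj_products k (g n) (G n). r \<le> d n x c) U" for K
    using far[of K]
  proof eventually_elim
    case (elim n)
    then show ?case
      using conj_products_mono[of _ K "g n" "G n"] P_cl[OF X(1)[of "K + M"]] by blast
  qed
  then obtain x where x: "x \<in> carrier P"
    and x': "\<And>k. eventually (\<lambda>n. \<forall>c\<in>conj_products k (g n) (G n). r \<le> d n (x n) c) U"
    using saturation[of "\<lambda>k n x. \<forall>c\<in>conj_products k (g n) (G n). r \<le> d n x c"] by blast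
  obtain N where "near g N x" using near x by blast
  from nearD[OF this r] x'[of N] have "eventually (\<lambda>n. False) U"
    by eventually_elim (auto simp: not_le[symmetric])
  then show False using U_False by blast
qed

text \<open>For a representative \<open>g\<close> of a non-trivial class, simplicity gives each
  sequence some level, \<open>near_uniform\<close> a common one, and
  \<open>near_imp_coset_in_conj_products\<close> carries it to \<open>Q\<close>.\<close>

lemma is_simple_iff_boundedly_simple: "is_simple Q \<longleftrightarrow> boundedly_simple Q"
proof
  assume simple: "is_simple Q"
  show "boundedly_simple Q"
    unfolding boundedly_simple_def
  proof
    fix q assume q: "q \<in> carrier Q - {\<one>\<^bsub>Q\<^esub>}"
    then obtain g where g: "g \<in> carrier P" "q = E #>\<^bsub>P\<^esub> g" by (auto simp: carrier_Q)
    then have "g \<notin> E" using q P.coset_join2[OF g(1) subgroup_E] by (auto simp: one_Q)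
    then obtain N where N: "\<And>x. x \<in> carrier P \<Longrightarrow> near g N x"
      using near_uniform[OF g(1)] is_simple_imp_near[OF simple g(1)] by blast
    have "carrier Q \<subseteq> conj_products N q Q"
      using near_imp_coset_in_conj_products[OF g(1) _ N] g(2) by (auto simp: carrier_Q)
    then show "\<exists>N. conj_products N q Q = carrier Q"
      using Q.conj_products_subset[of q N] q by blast
  qed
qed (rule Q.boundedly_simple_imp_is_simple)

end

theorem corollary3p9:
  fixes G :: "nat \<Rightarrow> 'a monoid"
    and nrm :: "nat \<Rightarrow> 'a \<Rightarrow> ennreal"
    and U :: "nat filter"
  assumes "\<And>n. metric_group (G n) (nrm n)"
    and "Sup {nrm n g | n g. g \<in> carrier (G n)} < \<infinity>"
    and "nonprincipal_ultrafilter U"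
  shows "is_simple (metric_ultraproduct G nrm U) \<longleftrightarrow>
         boundedly_simple (metric_ultraproduct G nrm U)"
proof -
  interpret metric_group_sequence G nrm U
    using assms(1,3) by (rule metric_group_sequence.intro)
  show ?thesis by (rule is_simple_iff_boundedly_simple)
qed

end
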